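(* Let $\chi > 1$ be a real number and let $m \ge 1$ be an integer. Then $$\mathcal{S}_m(\chi) = \frac{(1-2m)\,\chi\,\mathcal{P}_m(\chi) - (1-2m)\,\mathcal{P}_{m-1}(\chi)}{\chi^2-1}.$$
   Context: For an integer $m \ge 0$ and real $\chi > 1$, define $$\mathcal{P}_m(\chi) = \int_0^{2\pi} \frac{\cos m\varphi}{\sqrt{\chi-\cos\varphi}}\, d\varphi, \qquad \mathcal{S}_m(\chi) = \int_0^{2\pi} \frac{\cos m\varphi}{(\chi-\cos\varphi)^{3/2}}\, d\varphi .$$ *)

theory Defs
  imports "HOL-Analysis.Analysis"
begin

text \<open>The parameter \<open>x\<close> (written chi in the source; that letter is a binder in HOL-Analysis) is meant to range over \<open>x > 1\<close>, where both
  integrands are continuous on \<open>[0, 2\<pi>]\<close>.\<close>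

definition P_int :: "nat \<Rightarrow> real \<Rightarrow> real" where
  "P_int m x = integral {0..2 * pi} (\<lambda>\<phi>. cos (real m * \<phi>) / sqrt (x - cos \<phi>))"

definition S_int :: "nat \<Rightarrow> real \<Rightarrow> real" where
  "S_int m x = integral {0..2 * pi} (\<lambda>\<phi>. cos (real m * \<phi>) / (x - cos \<phi>) powr (3 / 2))"

end

theory Submission
  imports Defs
begin

text \<open>
  The identity is the integral over one period of a total derivative. With \<open>D = x - cos \<phi>\<close>, put
  \<open>F \<phi> = 2 * (x * sin (m * \<phi>) - sin ((m - 1) * \<phi>)) / sqrt D\<close>. Its derivative
  (\<open>recurrence_antiderivative\<close>) is the integrand of
  \<open>(x\<^sup>2 - 1) * S_int m x - (1 - 2 * m) * (x * P_int m x - P_int (m - 1) x)\<close>,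
  and \<open>F\<close> vanishes at both \<open>0\<close> and \<open>2 * pi\<close>, so this combination is zero.

  One finds \<open>F\<close> by looking for an antiderivative \<open>(A\<^sub>0 + x * A\<^sub>1) / sqrt D\<close> with trigonometric
  polynomials \<open>A\<^sub>0\<close>, \<open>A\<^sub>1\<close> independent of \<open>x\<close>, and comparing powers of \<open>x\<close> after multiplication by
  \<open>D powr (3/2)\<close>: the coefficient of \<open>x\<^sup>2\<close> forces the derivative of \<open>A\<^sub>1\<close> to be
  \<open>2 * m * cos (m * \<phi>)\<close>, that of \<open>x\<close> forces the derivative of \<open>A\<^sub>0\<close> to be
  \<open>- 2 * (m - 1) * cos ((m - 1) * \<phi>)\<close>, and the constant terms then agree by the addition formulas.
\<close>

lemma powr_three_halves:
  fixes D :: real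
  assumes "D > 0"
  shows "D powr (3 / 2) = D * sqrt D"
proof -
  have "D powr (3 / 2) = D powr (1 + 1 / 2)" by simp
  also have "\<dots> = D * sqrt D"
    using assms by (simp only: powr_add powr_one powr_half_sqrt less_imp_le)
  finally show ?thesis .
qed

text \<open>
  After clearing the factor \<open>(x - cos \<phi>) powr (3/2)\<close>, the formula for the derivative of \<open>F\<close> is a
  polynomial identity in the sines and cosines of \<open>t = (m-1)\<phi>\<close> and \<open>\<phi>\<close> modulo
  \<open>sin\<^sup>2 \<phi> + cos\<^sup>2 \<phi> = 1\<close>.
\<close>
lemma numerator_identity:
  fixes x m t \<phi> :: real
  shows "2 * (x * (m * cos (t + \<phi>)) - (m - 1) * cos t) * (x - cos \<phi>)
      - (x * sin (t + \<phi>) - sin t) * sin \<phi>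
    = (x\<^sup>2 - 1) * cos (t + \<phi>)
      - (1 - 2 * m) * (x * cos (t + \<phi>) - cos t) * (x - cos \<phi>)"
proof -
  have "(sin \<phi>)\<^sup>2 = 1 - (cos \<phi>)\<^sup>2" by (simp add: sin_squared_eq)
  then show ?thesis unfolding cos_add sin_add by algebra
qed

lemma recurrence_antiderivative:
  fixes x m \<phi> :: real
  assumes "x > 1"
  shows "((\<lambda>\<phi>. 2 * (x * sin (m * \<phi>) - sin ((m - 1) * \<phi>)) / sqrt (x - cos \<phi>))
    has_real_derivative
      (x\<^sup>2 - 1) * (cos (m * \<phi>) / (x - cos \<phi>) powr (3 / 2))
      - (1 - 2 * m) * (x * (cos (m * \<phi>) / sqrt (x - cos \<phi>))
          - cos ((m - 1) * \<phi>) / sqrt (x - cos \<phi>))) (at \<phi> within S)"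
proof -
  define D where "D = x - cos \<phi>"
  have D: "D > 0" using assms cos_le_one[of \<phi>] unfolding D_def by linarith
  define r where "r = sqrt D"
  have r: "r > 0" "D = r * r" using D by (simp_all add: r_def)
  define N where "N = x * sin (m * \<phi>) - sin ((m - 1) * \<phi>)"
  define N' where "N' = x * (m * cos (m * \<phi>)) - (m - 1) * cos ((m - 1) * \<phi>)"
  have shift: "(m - 1) * \<phi> + \<phi> = m * \<phi>" by (simp add: algebra_simps)
  have num: "2 * N' * D - N * sin \<phi> = (x\<^sup>2 - 1) * cos (m * \<phi>)
      - (1 - 2 * m) * (x * cos (m * \<phi>) - cos ((m - 1) * \<phi>)) * D"
    using numerator_identity[of x m "(m - 1) * \<phi>" \<phi>]
    unfolding shift N_def N'_def D_def .
  have "((\<lambda>\<phi>. 2 * (x * sin (m * \<phi>) - sin ((m - 1) * \<phi>)) / sqrt (x - cos \<phi>))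
      has_real_derivative (2 * N' * r - 2 * N * (sin \<phi> / (2 * r))) / (r * r)) (at \<phi> within S)"
    unfolding N_def N'_def r_def D_def
    using D unfolding D_def
    by (auto intro!: derivative_eq_intros simp: field_simps)
  also have "(2 * N' * r - 2 * N * (sin \<phi> / (2 * r))) / (r * r)
      = (2 * N' * D - N * sin \<phi>) / (D * r)"
    using r by (simp add: field_simps)
  also have "\<dots> = (x\<^sup>2 - 1) * (cos (m * \<phi>) / (D * r))
      - (1 - 2 * m) * (x * (cos (m * \<phi>) / r) - cos ((m - 1) * \<phi>) / r)"
    unfolding num using D r(1) by (simp add: field_simps)
  finally show ?thesis
    using D by (simp add: powr_three_halves r_def D_def)
qed

theorem lemmaA2:
  fixes x :: real and m :: nat
  assumes "x > 1" and "m \<ge> 1"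
  shows "S_int m x =
    ((1 - 2 * real m) * x * P_int m x - (1 - 2 * real m) * P_int (m - 1) x) / (x\<^sup>2 - 1)"
proof -
  let ?I = "{0..2 * pi}"
  let ?F = "\<lambda>\<phi>. 2 * (x * sin (real m * \<phi>) - sin ((real m - 1) * \<phi>)) / sqrt (x - cos \<phi>)"
  have pos: "x - cos \<phi> > 0" for \<phi>
    using assms(1) cos_le_one[of \<phi>] by linarith
  have ne: "cos \<phi> \<noteq> x" for \<phi>
    using pos[of \<phi>] by auto
  have P: "((\<lambda>\<phi>. cos (real k * \<phi>) / sqrt (x - cos \<phi>)) has_integral P_int k x) ?I" for k
    unfolding P_int_def
    by (intro integrable_integral integrable_continuous_interval continuous_intros)
      (use ne in auto)
  have S: "((\<lambda>\<phi>. cos (real m * \<phi>) / (x - cos \<phi>) powr (3 / 2)) has_integral S_int m x) ?I"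
    unfolding S_int_def
    by (intro integrable_integral integrable_continuous_interval continuous_intros)
      (use ne in auto)
  have m: "real (m - 1) = real m - 1" using assms(2) by simp
  have "((\<lambda>\<phi>. (x\<^sup>2 - 1) * (cos (real m * \<phi>) / (x - cos \<phi>) powr (3 / 2))
      - (1 - 2 * real m) * (x * (cos (real m * \<phi>) / sqrt (x - cos \<phi>))
          - cos ((real m - 1) * \<phi>) / sqrt (x - cos \<phi>)))
      has_integral (?F (2 * pi) - ?F 0)) ?I"
    using recurrence_antiderivative[OF assms(1)]
    by (intro fundamental_theorem_of_calculus)
      (simp_all add: has_real_derivative_iff_has_vector_derivative)
  moreover have "?F (2 * pi) - ?F 0 = 0"
  proof -
    have "sin (real k * (2 * pi)) = 0" for k
      using sin_npi[of "2 * k"] by (simp add: mult_ac)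
    from this[of m] this[of "m - 1", unfolded m] show ?thesis by simp
  qed
  moreover have "((\<lambda>\<phi>. (x\<^sup>2 - 1) * (cos (real m * \<phi>) / (x - cos \<phi>) powr (3 / 2))
      - (1 - 2 * real m) * (x * (cos (real m * \<phi>) / sqrt (x - cos \<phi>))
          - cos ((real m - 1) * \<phi>) / sqrt (x - cos \<phi>)))
      has_integral ((x\<^sup>2 - 1) * S_int m x
        - (1 - 2 * real m) * (x * P_int m x - P_int (m - 1) x))) ?I"
    by (intro has_integral_diff has_integral_mult_right S P P[of "m - 1", unfolded m])
  ultimately have "(x\<^sup>2 - 1) * S_int m x
      - (1 - 2 * real m) * (x * P_int m x - P_int (m - 1) x) = 0"
    by (simp only: has_integral_unique)
  moreover have "x\<^sup>2 - 1 > 0" using assms(1) by (simp add: one_less_power)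
  ultimately show ?thesis by (simp add: field_simps)
qed

end
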